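(* Let $w\in\mathbb{C}\setminus\{b\}$. All the solutions $z$ of $f(z)=w$ have the form $$z=g_{\sigma}(w)=(w-b)\prod_{n=1}^{\infty}\frac{a}{Q\bigl(P^{-1}_{\sigma_n}\circ\cdots\circ P^{-1}_{\sigma_1}(w)\bigr)},\qquad \sigma\in\Sigma,$$ and each solution is counted according to its multiplicity; that is, the set of solutions of $f(z)=w$ is $\{g_\sigma(w)\}_{\sigma\in\Sigma}$, and the multiplicity of $z_0$ as a zero of $f-w$ equals $\#\{\sigma\in\Sigma:\ g_\sigma(w)=z_0\}$.
   Context: Let $P$ be a complex polynomial of degree $d\ge 2$ and let $b\in\mathbb{C}$, $b\ne 0$, be a repelling fixed point of $P$: $P(b)=b$ and $|a|>1$, where $a:=P'(b)$. Let $f$ be the entire solution of $f(az)=P(f(z))$ ($z\in\mathbb{C}$) with $f(0)=b$, $f'(0)=1$; equivalently $f(z)=\lim_{n\to\infty}P^{\circ n}(b+a^{-n}z)$, uniformly on compact sets. Branches of $P^{-1}$: fix functions $P_0^{-1},\dots,P_{d-1}^{-1}:\mathbb{C}\to\mathbb{C}$ such that for every $w\in\mathbb{C}$ the list $P_0^{-1}(w),\dots,P_{d-1}^{-1}(w)$ is the complete list of solutions $z$ of $P(z)=w$, counted with multiplicity. The principal branch $P_0^{-1}$ satisfies $P_0^{-1}(b)=b$ and is analytic in some open neighbourhood of $b$; otherwise the numbering of the branches is arbitrary and no continuity is required. Standing assumption (Hypothesis 1): for every $w\in\mathbb{C}$, the $n$-fold iterate $(P_0^{-1})^{\circ n}(w)\to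 b$ as $n\to\infty$. $Q$ is the polynomial $Q(z):=\frac{P(z)-b}{z-b}$ (so $Q(b)=a$). With $\mathbb{N}=\{1,2,\dots\}$, $$\Sigma=\{\sigma:\mathbb{N}\to\{0,\dots,d-1\}:\ \lim_{n\to\infty}\sigma_n=0\},$$ i.e. sequences which are eventually $0$. Infinite products over $n$ are limits of partial products. *)

theory Defs
  imports
    "HOL-Complex_Analysis.Complex_Analysis"
    "HOL-Computational_Algebra.Computational_Algebra"
begin

text \<open>
  \<open>B i w\<close> is the value of the \<open>i\<close>-th branch of the inverse of \<open>P\<close> at \<open>w\<close>. The multiset equation
  says that \<open>B 0 w, \<dots>, B (d - 1) w\<close> lists the solutions of \<open>P z = w\<close> with multiplicity,
  where \<open>d\<close> is the degree of \<open>P\<close>. For \<open>i \<ge> d\<close> the function \<open>B i\<close> is irrelevant.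
\<close>

definition inverse_branches :: "complex poly \<Rightarrow> (nat \<Rightarrow> complex \<Rightarrow> complex) \<Rightarrow> bool" where
  "inverse_branches P B \<longleftrightarrow>
     (\<forall>w. image_mset (\<lambda>i. B i w) (mset_set {..<degree P}) = proots (P - [:w:]))"

text \<open>
  The division is exact when \<open>b\<close> is a fixed point of \<open>P\<close>.
\<close>

definition quot_poly :: "complex poly \<Rightarrow> complex \<Rightarrow> complex poly" where
  "quot_poly P b = (P - [:b:]) div [:- b, 1:]"

text \<open>
  Index sequences are numbered from \<open>0\<close>: here \<open>\<sigma> n\<close> stands for the mathematical
  \<open>\<sigma>\<^sub>n\<^sub>+\<^sub>1\<close>, so that no value at a spurious index distorts the counting of sequences.
  The limit is in the discrete space \<^typ>\<open>nat\<close>, so \<open>\<sigma>\<close> is eventually \<open>0\<close>.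
\<close>

definition index_seqs :: "nat \<Rightarrow> (nat \<Rightarrow> nat) set" where
  "index_seqs d = {\<sigma>. (\<forall>n. \<sigma> n < d) \<and> \<sigma> \<longlonglongrightarrow> 0}"

primrec branch_orbit ::
  "(nat \<Rightarrow> complex \<Rightarrow> complex) \<Rightarrow> (nat \<Rightarrow> nat) \<Rightarrow> complex \<Rightarrow> nat \<Rightarrow> complex" where
  "branch_orbit B \<sigma> w 0 = w"
| "branch_orbit B \<sigma> w (Suc n) = B (\<sigma> n) (branch_orbit B \<sigma> w n)"

definition partial_product ::
  "complex poly \<Rightarrow> complex \<Rightarrow> (nat \<Rightarrow> complex \<Rightarrow> complex) \<Rightarrow> (nat \<Rightarrow> nat) \<Rightarrow> complex \<Rightarrow> nat \<Rightarrow> complex" where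
  "partial_product P b B \<sigma> w N =
     (\<Prod>n=1..N. poly (pderiv P) b / poly (quot_poly P b) (branch_orbit B \<sigma> w n))"

text \<open>
  The infinite product is the plain limit of the partial products; unlike \<^const>\<open>has_prod\<close>,
  this does not require the limit to be nonzero.
\<close>

definition g_sol ::
  "complex poly \<Rightarrow> complex \<Rightarrow> (nat \<Rightarrow> complex \<Rightarrow> complex) \<Rightarrow> (nat \<Rightarrow> nat) \<Rightarrow> complex \<Rightarrow> complex" where
  "g_sol P b B \<sigma> w = (w - b) * lim (partial_product P b B \<sigma> w)"

end

theory Submission
  imports Defs
begin

text \<open>
  Along an orbit \<open>w\<^sub>n\<close> of the branches, \<open>w\<^sub>n\<^sub>-\<^sub>1 - b = P w\<^sub>n - b = (w\<^sub>n - b) Q(w\<^sub>n)\<close>, so the product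
  telescopes and \<open>(w - b)\<close> times its partial products is \<open>a\<^sup>N (w\<^sub>N - b)\<close>. If \<open>\<sigma>\<close> is eventually
  zero, the orbit tends to \<open>b\<close>; since \<open>f\<close> is injective near \<open>0\<close> and \<open>f (a z) = P (f z)\<close>, there is a
  single point \<open>z\<close> with \<open>w\<^sub>n = f (z / a\<^sup>n)\<close> for all \<open>n\<close>, and \<open>a\<^sup>N (w\<^sub>N - b)\<close> tends to it because
  \<open>f' 0 = 1\<close>. Hence \<open>g\<^sub>\<sigma>(w) = z\<close> exactly when \<open>\<sigma>\<close> selects the orbit \<open>f (z / a\<^sup>n)\<close>, and near \<open>b\<close> only
  the principal branch can do this. Replacing \<open>z\<close> by \<open>z / a\<close> divides both the number of such \<open>\<sigma>\<close>
  and the multiplicity of \<open>f\<close> at \<open>z\<close> by the multiplicity of \<open>f (z / a)\<close> as a root of \<open>P - f z\<close>,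
  and for small \<open>z\<close> both are \<open>1\<close>.
\<close>

section \<open>Orders of zeros: polynomial compositions and injective functions\<close>

text \<open>Split \<open>p\<close> as \<open>[:- g z, 1:] ^ m * q\<close> with \<open>q\<close>
  nonzero at \<open>g z\<close>: the factor from \<open>q\<close> has order 0, and since
  \<open>g\<close> is not locally constant, orders add over products and multiply under
  powers.\<close>

lemma zorder_poly_compose:
  fixes p :: "complex poly"
  assumes g: "g analytic_on {z}" and nc: "\<forall>\<^sub>F x in at z. g x \<noteq> g z" and "p \<noteq> 0"
  shows "zorder (\<lambda>x. poly p (g x)) z = order (g z) p * zorder (\<lambda>x. g x - g z) z"
proof -
  define m where "m = order (g z) p"
  obtain q where q: "p = [:- g z, 1:] ^ m * q" "poly q (g z) \<noteq> 0"
    using order_decomp[OF \<open>p \<noteq> 0\<close>, of "g z"] by (auto simp: m_def poly_eq_0_iff_dvd)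
  have q_an: "(\<lambda>x. poly q (g x)) analytic_on {z}"
    unfolding poly_altdef using g by (intro analytic_intros)
  have "\<forall>\<^sub>F x in nhds z. poly q (g x) \<noteq> 0"
    using analytic_at_imp_isCont[OF q_an] q(2)
    by (simp add: isCont_def tendsto_imp_eventually_ne eventually_nhds_conv_at)
  then have nz: "\<forall>\<^sub>F x in at z. (g x - g z) ^ m * poly q (g x) \<noteq> 0"
    using nc by (auto simp: eventually_nhds_conv_at elim: eventually_elim2)
  have "zorder (\<lambda>x. poly p (g x)) z = zorder (\<lambda>x. (g x - g z) ^ m * poly q (g x)) z"
    by (simp add: q(1) poly_mult poly_power algebra_simps)
  also have "\<dots> = zorder (\<lambda>x. (g x - g z) ^ m) z + zorder (\<lambda>x. poly q (g x)) z"
    using g q_an nz by (intro zorder_times_analytic analytic_intros) auto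
  also have "zorder (\<lambda>x. poly q (g x)) z = 0"
    using q_an q(2) by (rule zorder_eq_0I)
  also have "zorder (\<lambda>x. (g x - g z) ^ m) z = m * zorder (\<lambda>x. g x - g z) z"
    using g nc by (intro zorder_power analytic_on_imp_meromorphic_on analytic_intros
        eventually_frequently) auto
  finally show ?thesis
    by (simp add: m_def)
qed

lemma zorder_injective:
  assumes "f holomorphic_on S" "open S" "inj_on f S" "z \<in> S"
  shows "zorder (\<lambda>x. f x - f z) z = 1"
proof (rule zorder_zero_eqI)
  show "(\<lambda>x. f x - f z) holomorphic_on S"
    using assms by (intro holomorphic_intros)
  have "f field_differentiable at z"
    using assms by (meson holomorphic_on_imp_differentiable_at)
  then have "deriv (\<lambda>x. f x - f z) z = deriv f z"
    by simp
  then show "(deriv ^^ nat 1) (\<lambda>x. f x - f z) z \<noteq> 0"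
    using holomorphic_injective_imp_regular[OF assms] by simp
qed (use assms in auto)

section \<open>Index sequences and inverse branches\<close>

lemma index_seqs_iff: "\<sigma> \<in> index_seqs d \<longleftrightarrow> (\<forall>n. \<sigma> n < d) \<and> (\<forall>\<^sub>F n in sequentially. \<sigma> n = 0)"
  by (simp add: index_seqs_def tendsto_discrete)

lemma case_nat_in_index_seqs_iff:
  "case_nat i \<tau> \<in> index_seqs d \<longleftrightarrow> i < d \<and> \<tau> \<in> index_seqs d"
proof -
  have "(\<forall>\<^sub>F n in sequentially. case_nat i \<tau> n = 0) \<longleftrightarrow> (\<forall>\<^sub>F n in sequentially. \<tau> n = 0)"
    by (subst eventually_sequentially_Suc[symmetric]) simp
  moreover have "(\<forall>n. case_nat i \<tau> n < d) \<longleftrightarrow> i < d \<and> (\<forall>n. \<tau> n < d)"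
    by (metis nat.case(1) nat.case(2) nat.exhaust)
  ultimately show ?thesis
    by (auto simp: index_seqs_iff)
qed

lemma inverse_branches_card:
  assumes "inverse_branches P B" "degree P > 0"
  shows "card {i. i < degree P \<and> B i w = v} = order v (P - [:w:])"
proof -
  have "P - [:w:] \<noteq> 0"
    using assms(2) by (metis degree_pCons_0 eq_iff_diff_eq_0 less_irrefl)
  then have "order v (P - [:w:]) = count (proots (P - [:w:])) v"
    by simp
  also have "\<dots> = count (image_mset (\<lambda>i. B i w) (mset_set {..<degree P})) v"
    using assms(1) by (simp add: inverse_branches_def)
  also have "\<dots> = card {i. i < degree P \<and> B i w = v}"
    by (subst count_image_mset_eq_card_vimage) auto
  finally show ?thesis ..
qed

lemma inverse_branches_iff:
  assumes "inverse_branches P B" "degree P > 0"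
  shows "poly P v = w \<longleftrightarrow> (\<exists>i<degree P. B i w = v)"
proof -
  have "P - [:w:] \<noteq> 0"
    using assms(2) by (metis degree_pCons_0 eq_iff_diff_eq_0 less_irrefl)
  then have "poly P v = w \<longleftrightarrow> order v (P - [:w:]) \<noteq> 0"
    by (simp add: order_eq_0_iff)
  also have "\<dots> \<longleftrightarrow> {i. i < degree P \<and> B i w = v} \<noteq> {}"
    by (subst inverse_branches_card[OF assms, symmetric]) (simp add: card_eq_0_iff)
  finally show ?thesis
    by auto
qed

section \<open>Telescoping of the product and convergence of branch orbits\<close>

lemma poly_eq_quot_poly:
  assumes "poly P b = b"
  shows "poly P u - b = (u - b) * poly (quot_poly P b) u"
proof -
  have "[:- b, 1:] dvd P - [:b:]"
    using assms by (simp flip: poly_eq_0_iff_dvd)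
  then have "[:- b, 1:] * quot_poly P b = P - [:b:]"
    unfolding quot_poly_def by (rule dvd_mult_div_cancel)
  then have "poly ([:- b, 1:] * quot_poly P b) u = poly (P - [:b:]) u"
    by simp
  then show ?thesis
    by (simp add: algebra_simps del: mult_pCons_left)
qed

lemma partial_product_eq:
  assumes "poly P b = b" "w \<noteq> b" and orbit: "\<And>n. poly P (branch_orbit B \<sigma> w (Suc n)) = branch_orbit B \<sigma> w n"
  shows "(w - b) * partial_product P b B \<sigma> w N = poly (pderiv P) b ^ N * (branch_orbit B \<sigma> w N - b)"
proof (induction N)
  case 0
  show ?case
    by (simp add: partial_product_def)
next
  case (Suc N)
  define v where "v n = branch_orbit B \<sigma> w n" for n
  \<comment> \<open>\<open>b\<close> is fixed by \<open>P\<close>, so an orbit reaching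
    \<open>b\<close> would have started there. Hence no denominator
    \<open>poly (quot_poly P b) (v (Suc N))\<close> vanishes either.\<close>
  have "v n \<noteq> b" for n
    by (induction n) (use assms orbit in \<open>auto simp: v_def\<close>)
  moreover have "v N - b = (v (Suc N) - b) * poly (quot_poly P b) (v (Suc N))"
    using poly_eq_quot_poly[OF assms(1)] orbit by (metis v_def)
  ultimately have "(v N - b) / poly (quot_poly P b) (v (Suc N)) = v (Suc N) - b"
    by (metis mult_zero_right nonzero_mult_div_cancel_right right_minus_eq)
  moreover have "(w - b) * partial_product P b B \<sigma> w (Suc N) =
      ((w - b) * partial_product P b B \<sigma> w N) *
      (poly (pderiv P) b / poly (quot_poly P b) (v (Suc N)))"
    by (simp add: partial_product_def v_def)
  moreover have "x * y * (z / q) = z * x * (y / q)" for x y z q :: complex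
    by simp
  ultimately show ?case
    unfolding Suc.IH by (simp only: v_def power_Suc)
qed

lemma branch_orbit_add:
  "branch_orbit B \<sigma> w (M + n) = branch_orbit B (\<lambda>k. \<sigma> (M + k)) (branch_orbit B \<sigma> w M) n"
  by (induction n) auto

lemma branch_orbit_zero: "(\<And>k. \<sigma> k = 0) \<Longrightarrow> branch_orbit B \<sigma> w n = (B 0 ^^ n) w"
  by (induction n) auto

text \<open>Once the indices have become 0, the orbit is a plain iteration of \<open>B 0\<close>
  from the point reached so far.\<close>

lemma branch_orbit_tendsto:
  assumes "\<sigma> \<in> index_seqs d" and B: "\<And>u. (\<lambda>n. (B 0 ^^ n) u) \<longlonglongrightarrow> b"
  shows "branch_orbit B \<sigma> w \<longlonglongrightarrow> b"
proof -
  obtain M where "\<sigma> n = 0" if "n \<ge> M" for n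
    using assms(1) by (auto simp: index_seqs_iff eventually_sequentially)
  then have "branch_orbit B \<sigma> w (n + M) = (B 0 ^^ n) (branch_orbit B \<sigma> w M)" for n
    by (subst add.commute, subst branch_orbit_add, subst branch_orbit_zero) auto
  then show ?thesis
    using B[of "branch_orbit B \<sigma> w M"] by (simp add: LIMSEQ_offset[of _ M])
qed

section \<open>The linearizing function and its backward orbits\<close>

text \<open>The fixed point enters as \<open>f 0\<close>: putting \<open>z = 0\<close> in
  \<open>fun_eq\<close> gives \<open>poly P (f 0) = f 0\<close>.\<close>

locale linearization =
  fixes P :: "complex poly" and a :: complex and f :: "complex \<Rightarrow> complex"
  assumes deg: "degree P > 0"
    and a: "norm a > 1"
    and hol: "f holomorphic_on UNIV"
    and fun_eq: "f (a * z) = poly P (f z)"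
    and deriv_0: "deriv f 0 = 1"
begin

lemma a_nz [simp]: "a \<noteq> 0"
  using a by auto

lemma fun_eq': "poly P (f (z / a)) = f z"
  using fun_eq[of "z / a"] by simp

lemma scaled_tendsto_0: "(\<lambda>n. z / a ^ n) \<longlonglongrightarrow> 0"
proof -
  have "(\<lambda>n. z * inverse a ^ n) \<longlonglongrightarrow> z * 0"
    using a by (intro tendsto_intros LIMSEQ_power_zero) (simp add: norm_inverse inverse_less_1_iff)
  then show ?thesis
    by (simp add: divide_inverse power_inverse)
qed

lemma isCont_f: "isCont f z"
  using holomorphic_on_imp_continuous_on[OF hol] by (simp add: continuous_on_eq_continuous_at)

lemma analytic_f: "f analytic_on A"
  using hol analytic_on_holomorphic by blast

lemma locally_injective: obtains r where "r > 0" "inj_on f (ball 0 r)"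
  using has_complex_derivative_locally_injective[OF hol, of 0] deriv_0 by auto

text \<open>Local injectivity at 0 makes \<open>f\<close> nonconstant, so by the identity theorem
  the zeros of \<open>f - c\<close> are isolated everywhere.\<close>

lemma eventually_not_const: "\<forall>\<^sub>F x in at z. f x \<noteq> c"
proof -
  obtain r where r: "r > 0" "inj_on f (ball 0 r)"
    by (rule locally_injective)
  have "f 0 \<noteq> f (of_real (r / 2))"
    using inj_onD[OF r(2), of 0 "of_real (r / 2)"] r(1) by auto
  then obtain y where "f y - c \<noteq> 0"
    by (metis eq_iff_diff_eq_0)
  then have "\<forall>\<^sub>F x in at z. f x - c \<noteq> 0 \<and> x \<in> UNIV"
    using hol by (intro non_zero_neighbour_alt) (auto intro!: holomorphic_intros)
  then show ?thesis
    by simp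
qed

text \<open>By the functional equation, \<open>f x - f z\<close> is \<open>P - [:f z:]\<close>
  evaluated at \<open>f (x / a)\<close>, and rescaling the variable by a nonzero factor preserves
  orders.\<close>

lemma zorder_scaling:
  "zorder (\<lambda>x. f x - f z) z =
     order (f (z / a)) (P - [:f z:]) * zorder (\<lambda>x. f x - f (z / a)) (z / a)"
proof -
  let ?g = "\<lambda>x. f (x / a)"
  have "P - [:f z:] \<noteq> 0"
    using deg by (metis degree_pCons_0 eq_iff_diff_eq_0 less_irrefl)
  moreover have "(\<lambda>x. x / a) analytic_on {z}"
    by (intro analytic_intros) auto
  then have "?g analytic_on {z}"
    using analytic_on_compose[OF _ analytic_f] by (fastforce simp: o_def)
  moreover have "\<forall>\<^sub>F x in at z. ?g x \<noteq> ?g z"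
  proof (rule eventually_compose_filterlim[OF eventually_not_const])
    show "filterlim (\<lambda>x. x / a) (at (z / a)) (at z)"
      by (intro filterlim_atI tendsto_intros) (auto simp: eventually_at_filter)
  qed
  ultimately have "zorder (\<lambda>x. poly (P - [:f z:]) (?g x)) z =
      order (?g z) (P - [:f z:]) * zorder (\<lambda>x. ?g x - ?g z) z"
    by (intro zorder_poly_compose)
  also have "zorder (\<lambda>x. ?g x - ?g z) z = zorder (\<lambda>x. f x - f (z / a)) (z / a)"
    using Meromorphic.zorder_scale[of "\<lambda>x. f x - f (z / a)" "inverse a" z]
    by (simp add: field_simps analytic_f analytic_on_imp_meromorphic_on analytic_intros)
  finally show ?thesis
    by (simp add: fun_eq')
qed

text \<open>For nonzero \<open>z\<close> this is \<open>z\<close> times the difference quotient of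
  \<open>f\<close> at 0 with increment \<open>z / a ^ n\<close>.\<close>

lemma orbit_tendsto:
  "(\<lambda>n. a ^ n * (f (z / a ^ n) - f 0)) \<longlonglongrightarrow> z"
proof (cases "z = 0")
  case False
  have "(f has_field_derivative 1) (at 0)"
    using hol deriv_0 by (metis DERIV_deriv_iff_field_differentiable UNIV_I
        holomorphic_on_imp_differentiable_at open_UNIV)
  then have "((\<lambda>h. (f h - f 0) / h) \<longlongrightarrow> 1) (at 0)"
    by (simp add: has_field_derivative_iff)
  moreover have "filterlim (\<lambda>n. z / a ^ n) (at 0) sequentially"
    using scaled_tendsto_0 False by (auto intro!: filterlim_atI)
  ultimately have "(\<lambda>n. (f (z / a ^ n) - f 0) / (z / a ^ n)) \<longlonglongrightarrow> 1"
    by (rule filterlim_compose)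
  from tendsto_mult_left[OF this, of z] show ?thesis
    using False by (simp add: mult.commute)
qed auto

text \<open>The tail of the orbit lifts through a local inverse of \<open>f\<close> at 0, and the
  scaling relation between the lifts determines \<open>z\<close>. The finitely many earlier terms
  follow by applying \<open>P\<close>.\<close>

lemma backward_orbit:
  assumes orbit: "\<And>n. poly P (v (Suc n)) = v n" and lim: "v \<longlonglongrightarrow> f 0"
  shows "\<exists>z. \<forall>n. v n = f (z / a ^ n)"
proof -
  obtain r where r: "r > 0" "inj_on f (ball 0 r)"
    by (rule locally_injective)
  \<comment> \<open>Multiplication by \<open>a\<close> maps \<open>ball 0 s\<close> into
    \<open>ball 0 r\<close>, where \<open>f\<close> is still injective.\<close>
  define s where "s = r / norm a"
  have s: "0 < s" "s \<le> r"
    using r(1) a by (auto simp: s_def field_simps)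
  have "inj_on f (ball 0 s)"
    using r(2) by (rule inj_on_subset) (use s in auto)
  then have "open (f ` ball 0 s)"
    using hol by (intro open_mapping_thm3) (auto intro: holomorphic_on_subset)
  moreover have "f 0 \<in> f ` ball 0 s"
    using s by auto
  ultimately have "\<forall>\<^sub>F n in sequentially. v n \<in> f ` ball 0 s"
    by (intro topological_tendstoD[OF lim])
  then obtain N where "\<forall>n\<ge>N. v n \<in> f ` ball 0 s"
    unfolding eventually_sequentially by blast
  then have "\<forall>n. \<exists>t. n \<ge> N \<longrightarrow> t \<in> ball 0 s \<and> v n = f t"
    by blast
  then obtain t where t: "t n \<in> ball 0 s" "v n = f (t n)" if "n \<ge> N" for n
    by metis
  have step: "t n = a * t (Suc n)" if "n \<ge> N" for n
  proof (rule inj_onD[OF r(2)])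
    show "f (t n) = f (a * t (Suc n))"
      using orbit[of n] t(2)[of n] t(2)[of "Suc n"] that by (simp add: fun_eq)
    show "t n \<in> ball 0 r"
      using t(1)[of n] that s by auto
    show "a * t (Suc n) \<in> ball 0 r"
      using t(1)[of "Suc n"] that a by (auto simp: s_def norm_mult field_simps)
  qed
  define z where "z = a ^ N * t N"
  have "t (N + k) = z / a ^ (N + k)" for k
  proof (induction k)
    case (Suc k)
    then show ?case
      using step[of "N + k"] by (simp add: field_simps)
  qed (simp add: z_def)
  then have tail: "v (N + k) = f (z / a ^ (N + k))" for k
    using t(2)[of "N + k"] by simp
  have "v n = f (z / a ^ n)" if "n \<le> N" for n
    using that
  proof (induction n rule: inc_induct)
    case base
    show ?case
      using tail[of 0] by simp
  next
    case (step n)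
    then show ?case
      using orbit[of n] fun_eq'[of "z / a ^ n"] by (simp add: mult.commute)
  qed
  with tail show ?thesis
    by (metis le_add_diff_inverse nat_le_linear)
qed

end

section \<open>Counting the branch choices along an orbit\<close>

locale branched_linearization = linearization +
  fixes B :: "nat \<Rightarrow> complex \<Rightarrow> complex"
  assumes branches: "inverse_branches P B"
    and B0: "B 0 (f 0) = f 0"
    and cont_B0: "isCont (B 0) (f 0)"
begin

text \<open>Indexed by the point \<open>z\<close> rather than by the value \<open>f z\<close>, so
  that dropping the first index leads from \<open>z\<close> to \<open>z / a\<close>.\<close>

definition selectors :: "complex \<Rightarrow> (nat \<Rightarrow> nat) set" where
  "selectors z = {\<sigma> \<in> index_seqs (degree P). \<forall>n. B (\<sigma> n) (f (z / a ^ n)) = f (z / a ^ Suc n)}"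

lemma selectors_Suc:
  "selectors z =
     (\<lambda>(i, \<tau>). case_nat i \<tau>) ` ({i. i < degree P \<and> B i (f z) = f (z / a)} \<times> selectors (z / a))"
proof -
  have all_split: "(\<forall>n. Q n) \<longleftrightarrow> Q 0 \<and> (\<forall>n. Q (Suc n))" for Q :: "nat \<Rightarrow> bool"
    by (metis nat.exhaust)
  have iff: "case_nat i \<tau> \<in> selectors z \<longleftrightarrow>
      (i < degree P \<and> B i (f z) = f (z / a)) \<and> \<tau> \<in> selectors (z / a)" for i \<tau>
  proof -
    have "(\<forall>n. B (case_nat i \<tau> n) (f (z / a ^ n)) = f (z / a ^ Suc n)) \<longleftrightarrow>
        B i (f z) = f (z / a) \<and> (\<forall>n. B (\<tau> n) (f (z / a / a ^ n)) = f (z / a / a ^ Suc n))"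
      by (subst all_split) simp
    then show ?thesis
      by (auto simp: selectors_def case_nat_in_index_seqs_iff)
  qed
  show ?thesis
  proof (intro equalityI subsetI)
    fix \<sigma> assume "\<sigma> \<in> selectors z"
    moreover have "\<sigma> = case_nat (\<sigma> 0) (\<lambda>n. \<sigma> (Suc n))"
      by (auto simp: fun_eq_iff split: nat.split)
    ultimately show "\<sigma> \<in> (\<lambda>(i, \<tau>). case_nat i \<tau>) `
        ({i. i < degree P \<and> B i (f z) = f (z / a)} \<times> selectors (z / a))"
      using iff[of "\<sigma> 0" "\<lambda>n. \<sigma> (Suc n)"] by (intro image_eqI[of _ _ "(\<sigma> 0, \<lambda>n. \<sigma> (Suc n))"]) auto
  qed (use iff in auto)
qed

lemma inj_case_nat: "inj_on (\<lambda>(i, \<tau>). case_nat i \<tau> :: nat \<Rightarrow> nat) A"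
  by (rule inj_onI) (auto simp: fun_eq_iff split: nat.splits)

text \<open>The first index can be chosen in as many ways as the multiplicity of the root
  \<open>f (z / a)\<close>; the remaining indices form a selector for \<open>z / a\<close>.\<close>

lemma card_selectors_Suc:
  "card (selectors z) = order (f (z / a)) (P - [:f z:]) * card (selectors (z / a))"
  by (subst selectors_Suc)
     (simp add: card_image[OF inj_case_nat] card_cartesian_product inverse_branches_card[OF branches deg])

lemma finite_selectors_Suc: "finite (selectors (z / a)) \<Longrightarrow> finite (selectors z)"
  by (subst selectors_Suc) auto

text \<open>Provides the base of the count: near 0 the principal branch follows
  \<open>f (z / a)\<close>, and no other branch can, because that root is simple.\<close>

lemma local_behaviour:
  obtains r where "r > 0"
    "\<And>z. norm z < r \<Longrightarrow> zorder (\<lambda>x. f x - f z) z = 1"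
    "\<And>z. norm z < r \<Longrightarrow> {i. i < degree P \<and> B i (f z) = f (z / a)} = {0}"
proof -
  obtain r where r: "r > 0" "inj_on f (ball 0 r)"
    by (rule locally_injective)
  define s where "s = r / norm a"
  have s: "0 < s" "s \<le> r"
    using r(1) a by (auto simp: s_def field_simps)
  have "inj_on f (ball 0 s)"
    using r(2) by (rule inj_on_subset) (use s in auto)
  then have "open (f ` ball 0 s)"
    using hol by (intro open_mapping_thm3) (auto intro: holomorphic_on_subset)
  moreover have "(\<lambda>z. B 0 (f z)) \<midarrow>0\<rightarrow> B 0 (f 0)"
    using isCont_o2[OF isCont_f cont_B0] by (simp add: isCont_def)
  moreover have "B 0 (f 0) \<in> f ` ball 0 s"
    using s B0 by auto
  ultimately have "\<forall>\<^sub>F z in nhds 0. B 0 (f z) \<in> f ` ball 0 s"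
    by (auto simp: eventually_nhds_conv_at dest: topological_tendstoD)
  then obtain e where e: "e > 0" "\<And>z. norm z < e \<Longrightarrow> B 0 (f z) \<in> f ` ball 0 s"
    by (auto simp: eventually_nhds_metric)
  have zorder_1: "zorder (\<lambda>x. f x - f z) z = 1" if "norm z < r" for z
    using that r(2) hol by (intro zorder_injective[of f "ball 0 r"]) (auto intro: holomorphic_on_subset)
  \<comment> \<open>By continuity of \<open>B 0\<close>, the value is \<open>f t\<close> with
    \<open>a * t\<close> still in the disc of injectivity; applying \<open>P\<close> gives
    \<open>f (a * t) = f z\<close>.\<close>
  have principal: "B 0 (f z) = f (z / a)" if z: "norm z < min r e" for z
  proof -
    obtain t where t: "norm t < s" "B 0 (f z) = f t"
      using e(2)[of z] z by auto
    have "f (a * t) = f z"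
      using inverse_branches_iff[OF branches deg, of "f t" "f z"] t(2) deg by (auto simp: fun_eq)
    moreover have "norm (a * t) < r"
      using t(1) a by (auto simp: s_def norm_mult field_simps)
    ultimately have "a * t = z"
      using z inj_onD[OF r(2), of "a * t" z] by simp
    with t(2) show ?thesis
      by auto
  qed
  have "{i. i < degree P \<and> B i (f z) = f (z / a)} = {0}" if z: "norm z < min r e" for z
  proof -
    have "norm z / norm a \<le> norm z"
      using a mult_left_mono[of 1 "norm a" "norm z"] by (auto simp: field_simps)
    then have "norm (z / a) < r"
      using z by (simp add: norm_divide)
    \<comment> \<open>comparing orders at \<open>z\<close> and \<open>z / a\<close>, the root \<open>f (z / a)\<close> of \<open>P - f z\<close> is simple\<close>
    then have "order (f (z / a)) (P - [:f z:]) = 1"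
      using zorder_scaling[of z] z by (simp add: zorder_1)
    then obtain j where j: "{i. i < degree P \<and> B i (f z) = f (z / a)} = {j}"
      using inverse_branches_card[OF branches deg, of "f z" "f (z / a)"] by (auto simp: card_1_singleton_iff)
    moreover have "0 \<in> {i. i < degree P \<and> B i (f z) = f (z / a)}"
      using principal[OF z] deg by simp
    ultimately show ?thesis
      unfolding j by simp
  qed
  with zorder_1 show ?thesis
    using r(1) e(1) by (intro that[of "min r e"]) auto
qed

text \<open>Induction on a number \<open>N\<close> of divisions by \<open>a\<close> that bring
  \<open>z\<close> into the disc of \<open>local_behaviour\<close>; undoing one division multiplies
  both sides by the same root order.\<close>

lemma zorder_eq_card_selectors:
  "finite (selectors z) \<and> zorder (\<lambda>x. f x - f z) z = int (card (selectors z))"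
proof -
  obtain r where r: "r > 0"
    "\<And>z. norm z < r \<Longrightarrow> zorder (\<lambda>x. f x - f z) z = 1"
    "\<And>z. norm z < r \<Longrightarrow> {i. i < degree P \<and> B i (f z) = f (z / a)} = {0}"
    by (rule local_behaviour) blast
  have "norm (z / a ^ N) < r \<Longrightarrow> ?thesis" for N
  proof (induction N arbitrary: z)
    case 0
    have "selectors z = {\<lambda>_. 0}"
    proof -
      have "i < degree P \<and> B i (f (z / a ^ n)) = f (z / a ^ Suc n) \<longleftrightarrow> i = 0" for i n
      proof -
        \<comment> \<open>Division by powers of \<open>a\<close> never leaves the disc, so index 0
          is forced at every stage.\<close>
        have "norm z / norm a ^ n \<le> norm z / 1"
          using a by (intro divide_left_mono) auto
        then have "norm (z / a ^ n) < r"
          using 0 by (simp add: norm_divide norm_power)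
        from r(3)[OF this] show ?thesis
          by (auto simp: set_eq_iff mult.commute)
      qed
      then show ?thesis
        by (fastforce simp: selectors_def index_seqs_iff fun_eq_iff)
    qed
    then show ?case
      using 0 r(2) by simp
  next
    case (Suc N)
    then have "norm (z / a / a ^ N) < r"
      by simp
    from Suc.IH[OF this] show ?case
      using zorder_scaling[of z] card_selectors_Suc[of z] finite_selectors_Suc[of z] by simp
  qed
  moreover have "\<exists>N. norm (z / a ^ N) < r"
    using scaled_tendsto_0[of z] r(1) by (auto simp: tendsto_iff eventually_sequentially)
  ultimately show ?thesis
    by blast
qed

text \<open>Some branch hits the preimage \<open>f (z / a ^ Suc n)\<close> at each stage; once
  \<open>z / a ^ n\<close> is small its index must be 0, so any such choice is eventually 0.\<close>

lemma selectors_nonempty: "selectors z \<noteq> {}"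
proof -
  obtain r where r: "r > 0"
    "\<And>z. norm z < r \<Longrightarrow> {i. i < degree P \<and> B i (f z) = f (z / a)} = {0}"
    by (rule local_behaviour) blast
  have "\<exists>i. i < degree P \<and> B i (f (z / a ^ n)) = f (z / a ^ Suc n)" for n
    using inverse_branches_iff[OF branches deg, of "f (z / a ^ Suc n)" "f (z / a ^ n)"]
      fun_eq'[of "z / a ^ n"] by (simp add: mult.commute)
  then obtain \<sigma> where \<sigma>: "\<sigma> n < degree P" "B (\<sigma> n) (f (z / a ^ n)) = f (z / a ^ Suc n)" for n
    by metis
  have "\<forall>\<^sub>F n in sequentially. norm (z / a ^ n) < r"
    using scaled_tendsto_0[of z] r(1) by (auto simp: tendsto_iff)
  then have "\<forall>\<^sub>F n in sequentially. \<sigma> n = 0"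
  proof eventually_elim
    case (elim n)
    from r(2)[OF this] \<sigma>[of n] show ?case
      by (auto simp: set_eq_iff mult.commute)
  qed
  with \<sigma> have "\<sigma> \<in> selectors z"
    by (auto simp: selectors_def index_seqs_iff)
  then show ?thesis
    by auto
qed

text \<open>Turns the stepwise condition in \<open>selectors\<close> into a formula for the whole
  orbit of \<open>w\<close>; the case \<open>n = 0\<close> encodes \<open>f z = w\<close>.\<close>

lemma branch_orbit_eq_iff:
  "\<sigma> \<in> selectors z \<and> f z = w \<longleftrightarrow>
     \<sigma> \<in> index_seqs (degree P) \<and> (\<forall>n. branch_orbit B \<sigma> w n = f (z / a ^ n))"
proof
  assume L: "\<sigma> \<in> selectors z \<and> f z = w"
  have "branch_orbit B \<sigma> w n = f (z / a ^ n)" for n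
    by (induction n) (use L in \<open>auto simp: selectors_def\<close>)
  with L show "\<sigma> \<in> index_seqs (degree P) \<and> (\<forall>n. branch_orbit B \<sigma> w n = f (z / a ^ n))"
    by (simp add: selectors_def)
next
  assume R: "\<sigma> \<in> index_seqs (degree P) \<and> (\<forall>n. branch_orbit B \<sigma> w n = f (z / a ^ n))"
  then have "f z = w"
    by (metis branch_orbit.simps(1) div_by_1 power_0)
  moreover have "B (\<sigma> n) (f (z / a ^ n)) = f (z / a ^ Suc n)" for n
    using R by (metis branch_orbit.simps(2))
  ultimately show "\<sigma> \<in> selectors z \<and> f z = w"
    using R by (simp add: selectors_def)
qed

end

section \<open>Matching the values of the product with the solutions of
  \<open>f z = w\<close>\<close>

theorem corollary1p2:
  fixes P :: "complex poly" and b w :: complex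
    and f :: "complex \<Rightarrow> complex" and B :: "nat \<Rightarrow> complex \<Rightarrow> complex"
  assumes "degree P \<ge> 2"
    and "b \<noteq> 0"
    and "poly P b = b"
    and "norm (poly (pderiv P) b) > 1"
    and "f holomorphic_on UNIV"
    and "\<And>z. f (poly (pderiv P) b * z) = poly P (f z)"
    and "f 0 = b"
    and "deriv f 0 = 1"
    and "inverse_branches P B"
    and "B 0 b = b"
    and "B 0 analytic_on {b}"
    and "\<And>u. (\<lambda>n. (B 0 ^^ n) u) \<longlonglongrightarrow> b"
    and "w \<noteq> b"
  shows "(\<forall>\<sigma>\<in>index_seqs (degree P). convergent (partial_product P b B \<sigma> w)) \<and>
    {z. f z = w} = (\<lambda>\<sigma>. g_sol P b B \<sigma> w) ` index_seqs (degree P) \<and>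
    (\<forall>z0. f z0 = w \<longrightarrow>
       finite {\<sigma> \<in> index_seqs (degree P). g_sol P b B \<sigma> w = z0} \<and>
       zorder (\<lambda>z. f z - w) z0 = int (card {\<sigma> \<in> index_seqs (degree P). g_sol P b B \<sigma> w = z0}))"
proof -
  define a where "a = poly (pderiv P) b"
  have b: "f 0 = b"
    by (fact assms)
  interpret branched_linearization P a f B
  proof
    show "isCont (B 0) (f 0)"
      using assms(7,11) by (simp add: analytic_at_imp_isCont)
  qed (use assms in \<open>auto simp: a_def\<close>)
  have orbit: "poly P (branch_orbit B \<sigma> w (Suc n)) = branch_orbit B \<sigma> w n"
    if "\<sigma> \<in> index_seqs (degree P)" for \<sigma> n
    using that inverse_branches_iff[OF branches deg] by (auto simp: index_seqs_iff)
  have partial: "partial_product P b B \<sigma> w = (\<lambda>N. a ^ N * (branch_orbit B \<sigma> w N - b) / (w - b))"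
    if "\<sigma> \<in> index_seqs (degree P)" for \<sigma>
    using partial_product_eq[OF assms(3,13) orbit[OF that]] assms(13)
    by (auto simp: fun_eq_iff a_def field_simps)
  have lim: "partial_product P b B \<sigma> w \<longlonglongrightarrow> z / (w - b)" "g_sol P b B \<sigma> w = z"
    if "\<sigma> \<in> selectors z" "f z = w" for \<sigma> z
  proof -
    have \<sigma>: "\<sigma> \<in> index_seqs (degree P)" "\<And>n. branch_orbit B \<sigma> w n = f (z / a ^ n)"
      using that branch_orbit_eq_iff by blast+
    show lim: "partial_product P b B \<sigma> w \<longlonglongrightarrow> z / (w - b)"
      unfolding partial[OF \<sigma>(1)] \<sigma>(2)
      using orbit_tendsto[of z] assms(13) by (intro tendsto_divide) (auto simp: b)
    show "g_sol P b B \<sigma> w = z"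
      using limI[OF lim] assms(13) by (simp add: g_sol_def)
  qed
  \<comment> \<open>Convergence of the iterates of \<open>B 0\<close> enters here: it drives the
    orbit to \<open>f 0\<close>, so that the orbit can be lifted.\<close>
  have ex: "\<exists>z. \<sigma> \<in> selectors z \<and> f z = w" if \<sigma>: "\<sigma> \<in> index_seqs (degree P)" for \<sigma>
  proof -
    have "branch_orbit B \<sigma> w \<longlonglongrightarrow> f 0"
      using branch_orbit_tendsto[where B = B, OF \<sigma> assms(12)] by (simp add: b)
    from backward_orbit[OF orbit[OF \<sigma>] this] show ?thesis
      using \<sigma> by (auto simp: branch_orbit_eq_iff)
  qed
  \<comment> \<open>By \<open>ex\<close>, each index sequence selects some solution, and by
    \<open>lim\<close> its product value is that solution; so the value \<open>z\<close> can only
    come from a selector of \<open>z\<close>.\<close>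
  have fibre: "{\<sigma> \<in> index_seqs (degree P). g_sol P b B \<sigma> w = z} = selectors z" if "f z = w" for z
    using ex lim(2) that by (force simp: selectors_def)
  show ?thesis
  proof (intro conjI ballI allI impI)
    fix \<sigma> assume "\<sigma> \<in> index_seqs (degree P)"
    then show "convergent (partial_product P b B \<sigma> w)"
      using ex lim(1) by (meson convergentI)
  next
    show "{z. f z = w} = (\<lambda>\<sigma>. g_sol P b B \<sigma> w) ` index_seqs (degree P)"
    proof (intro equalityI subsetI)
      fix z assume z: "z \<in> {z. f z = w}"
      obtain \<sigma> where "\<sigma> \<in> selectors z"
        using selectors_nonempty[of z] by blast
      then have "\<sigma> \<in> index_seqs (degree P)" "z = g_sol P b B \<sigma> w"
        using z lim(2) by (auto simp: selectors_def)
      then show "z \<in> (\<lambda>\<sigma>. g_sol P b B \<sigma> w) ` index_seqs (degree P)"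
        by blast
    qed (use ex lim(2) in blast)
  next
    fix z assume z: "f z = w"
    show "finite {\<sigma> \<in> index_seqs (degree P). g_sol P b B \<sigma> w = z}"
      "zorder (\<lambda>x. f x - w) z = int (card {\<sigma> \<in> index_seqs (degree P). g_sol P b B \<sigma> w = z})"
      unfolding fibre[OF z] using zorder_eq_card_selectors[of z] z by auto
  qed
qed

end
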